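(* Let $(\mathfrak{g},[~,~]_\mathfrak{g},\alpha)$ and $(\mathfrak{h},[~,~]_\mathfrak{h},\beta)$ be two (multiplicative) Hom-Lie algebras. Then the graded vector space $C^\bullet_{\mathrm{Hom}}(\mathfrak{g},\mathfrak{h})=\bigoplus_{n\ge 1}C^n_{\mathrm{Hom}}(\mathfrak{g},\mathfrak{h})$ together with the cup product bracket $[~,~]_{\mathsf{C}}$ is a graded Lie algebra.
   Context: All vector spaces and (multi)linear maps are over a field $\mathbf{k}$ of characteristic $0$. A (multiplicative) Hom-Lie algebra $(\mathfrak{g},[~,~],\alpha)$ is a vector space $\mathfrak{g}$ with a skew-symmetric bilinear map $[~,~]:\mathfrak{g}\times\mathfrak{g}\to\mathfrak{g}$ and a linear map $\alpha:\mathfrak{g}\to\mathfrak{g}$ such that $[\alpha(x),[y,z]]+[\alpha(y),[z,x]]+[\alpha(z),[x,y]]=0$ and $\alpha([x,y])=[\alpha(x),\alpha(y)]$ for all $x,y,z$. For $n\ge 1$, $C^n_{\mathrm{Hom}}(\mathfrak{g},\mathfrak{h})=\{f:\wedge^n\mathfrak{g}\to\mathfrak{h}\ \text{linear}\mid \beta\circ f=f\circ\alpha^{\wedge n}\}$; elements of it have degree $n$. $Sh(m,n)$ is the set of $(m,n)$-shuffles in $S_{m+n}$ (permutations $\sigma$ with $\sigma(1)<\cdots<\sigma(m)$ and $\sigma(m+1)<\cdots<\sigma(m+n)$), and $(-1)^\sigma$ is the sign of $\sigma$. The cup product bracket $[~,~]_{\mathsf{C}}:C^m_{\mathrm{Hom}}(\mathfrak{g},\mathfrak{h})\times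 C^n_{\mathrm{Hom}}(\mathfrak{g},\mathfrak{h})\to C^{m+n}_{\mathrm{Hom}}(\mathfrak{g},\mathfrak{h})$ ($m,n\ge1$) is $$[P,Q]_{\mathsf{C}}(x_1,\ldots,x_{m+n})=\sum_{\sigma\in Sh(m,n)}(-1)^\sigma[\beta^{n-1}P(x_{\sigma(1)},\ldots,x_{\sigma(m)}),\beta^{m-1}Q(x_{\sigma(m+1)},\ldots,x_{\sigma(m+n)})]_\mathfrak{h}.$$ A graded Lie algebra is a graded vector space with a degree $0$ bilinear bracket satisfying $[P,Q]=-(-1)^{|P||Q|}[Q,P]$ and $[P,[Q,R]]=[[P,Q],R]+(-1)^{|P||Q|}[Q,[P,R]]$ for homogeneous elements. *)

theory Defs
  imports
    Complex_Main
    "HOL-Library.Function_Algebras"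
    "HOL-Combinatorics.Permutations"
begin

section \<open>Hom-Lie algebras\<close>

locale hom_lie_algebra = vector_space scale
  for scale :: "'k::field_char_0 \<Rightarrow> 'a::ab_group_add \<Rightarrow> 'a"
    and bracket :: "'a \<Rightarrow> 'a \<Rightarrow> 'a"
    and \<alpha> :: "'a \<Rightarrow> 'a" +
  assumes linear_bracket_right: "Vector_Spaces.linear scale scale (\<lambda>y. bracket x y)"
    and linear_bracket_left: "Vector_Spaces.linear scale scale (\<lambda>x. bracket x y)"
    and skew_symmetric: "bracket x y = - bracket y x"
    and linear_twist: "Vector_Spaces.linear scale scale \<alpha>"
    and hom_jacobi:
      "bracket (\<alpha> x) (bracket y z) + bracket (\<alpha> y) (bracket z x)
        + bracket (\<alpha> z) (bracket x y) = 0"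
    and multiplicative: "\<alpha> (bracket x y) = bracket (\<alpha> x) (\<alpha> y)"


section \<open>Graded Lie algebras\<close>

text \<open>
  Gradings are internal: the homogeneous parts \<open>V i\<close>, for \<open>i\<close> in a set \<open>I\<close> of degrees closed under
  addition, are independent subspaces of an ambient vector space, and the graded vector space is
  their span. The ambient space may be larger than this span, and nothing is required of the
  bracket outside it.
\<close>

locale graded_vector_space = vector_space scale
  for scale :: "'k::field \<Rightarrow> 'v::ab_group_add \<Rightarrow> 'v"
    and I :: "nat set"
    and V :: "nat \<Rightarrow> 'v set" +
  assumes degree_add: "\<lbrakk>i \<in> I; j \<in> I\<rbrakk> \<Longrightarrow> i + j \<in> I"
    and subspace_homogeneous: "i \<in> I \<Longrightarrow> subspace (V i)"
    and independent_homogeneous: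
      "\<lbrakk>finite J; J \<subseteq> I; \<And>j. j \<in> J \<Longrightarrow> v j \<in> V j; (\<Sum>j\<in>J. v j) = 0; i \<in> J\<rbrakk> \<Longrightarrow> v i = 0"
begin

definition total :: "'v set" where
  "total = span (\<Union>i\<in>I. V i)"

end

locale graded_lie_algebra = graded_vector_space scale I V
  for scale :: "'k::field \<Rightarrow> 'v::ab_group_add \<Rightarrow> 'v"
    and I :: "nat set"
    and V :: "nat \<Rightarrow> 'v set"
    and bracket :: "'v \<Rightarrow> 'v \<Rightarrow> 'v" +
  assumes bracket_add_left:
      "\<lbrakk>P \<in> total; P' \<in> total; Q \<in> total\<rbrakk> \<Longrightarrow> bracket (P + P') Q = bracket P Q + bracket P' Q"
    and bracket_add_right:
      "\<lbrakk>P \<in> total; Q \<in> total; Q' \<in> total\<rbrakk> \<Longrightarrow> bracket P (Q + Q') = bracket P Q + bracket P Q'"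
    and bracket_scale_left:
      "\<lbrakk>P \<in> total; Q \<in> total\<rbrakk> \<Longrightarrow> bracket (scale c P) Q = scale c (bracket P Q)"
    and bracket_scale_right:
      "\<lbrakk>P \<in> total; Q \<in> total\<rbrakk> \<Longrightarrow> bracket P (scale c Q) = scale c (bracket P Q)"
    and bracket_degree:
      "\<lbrakk>p \<in> I; q \<in> I; P \<in> V p; Q \<in> V q\<rbrakk> \<Longrightarrow> bracket P Q \<in> V (p + q)"
    and graded_skew_symmetric:
      "\<lbrakk>p \<in> I; q \<in> I; P \<in> V p; Q \<in> V q\<rbrakk>
        \<Longrightarrow> bracket P Q = - scale ((-1) ^ (p * q)) (bracket Q P)"
    and graded_jacobi:
      "\<lbrakk>p \<in> I; q \<in> I; r \<in> I; P \<in> V p; Q \<in> V q; R \<in> V r\<rbrakk>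
        \<Longrightarrow> bracket P (bracket Q R)
            = bracket (bracket P Q) R + scale ((-1) ^ (p * q)) (bracket Q (bracket P R))"


section \<open>Cochains\<close>

text \<open>
  A linear map out of the \<open>n\<close>-th exterior power is given by the corresponding alternating
  multilinear map in \<open>n\<close> arguments. Argument tuples are lists, and an \<open>n\<close>-cochain is set to \<open>0\<close> on
  lists of any other length, so that cochains of all degrees lie in one function space, where
  cochains of different degrees are independent.
\<close>

definition alternating_maps ::
  "('k::field \<Rightarrow> 'g::ab_group_add \<Rightarrow> 'g) \<Rightarrow> ('k \<Rightarrow> 'h::ab_group_add \<Rightarrow> 'h) \<Rightarrow> nat
    \<Rightarrow> ('g list \<Rightarrow> 'h) set" where
  "alternating_maps scale\<^sub>g scale\<^sub>h n = {f.
     (\<forall>xs. length xs \<noteq> n \<longrightarrow> f xs = 0) \<and>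
     (\<forall>xs i. length xs = n \<and> i < n \<longrightarrow>
        Vector_Spaces.linear scale\<^sub>g scale\<^sub>h (\<lambda>x. f (xs[i := x]))) \<and>
     (\<forall>xs. length xs = n \<and> \<not> distinct xs \<longrightarrow> f xs = 0)}"

definition hom_cochains ::
  "('k::field \<Rightarrow> 'g::ab_group_add \<Rightarrow> 'g) \<Rightarrow> ('g \<Rightarrow> 'g)
    \<Rightarrow> ('k \<Rightarrow> 'h::ab_group_add \<Rightarrow> 'h) \<Rightarrow> ('h \<Rightarrow> 'h) \<Rightarrow> nat \<Rightarrow> ('g list \<Rightarrow> 'h) set" where
  "hom_cochains scale\<^sub>g \<alpha> scale\<^sub>h \<beta> n =
     {f \<in> alternating_maps scale\<^sub>g scale\<^sub>h n. \<forall>xs. length xs = n \<longrightarrow> \<beta> (f xs) = f (map \<alpha> xs)}"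


section \<open>The cup product bracket\<close>

text \<open>Positions are counted from \<open>0\<close>.\<close>

definition Sh :: "nat \<Rightarrow> nat \<Rightarrow> (nat \<Rightarrow> nat) set" where
  "Sh m n = {\<sigma>. \<sigma> permutes {..<m + n} \<and>
     strict_mono_on {..<m} \<sigma> \<and> strict_mono_on {m..<m + n} \<sigma>}"

definition cup ::
  "('k::field \<Rightarrow> 'h::ab_group_add \<Rightarrow> 'h) \<Rightarrow> ('h \<Rightarrow> 'h \<Rightarrow> 'h) \<Rightarrow> ('h \<Rightarrow> 'h) \<Rightarrow> nat \<Rightarrow> nat
    \<Rightarrow> ('g list \<Rightarrow> 'h) \<Rightarrow> ('g list \<Rightarrow> 'h) \<Rightarrow> ('g list \<Rightarrow> 'h)" where
  "cup scale\<^sub>h bracket\<^sub>h \<beta> m n P Q = (\<lambda>xs.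
     if length xs = m + n then
       \<Sum>\<sigma>\<in>Sh m n. scale\<^sub>h (of_int (sign \<sigma>))
         (bracket\<^sub>h
           ((\<beta> ^^ (n - 1)) (P (map (\<lambda>i. xs ! \<sigma> i) [0..<m])))
           ((\<beta> ^^ (m - 1)) (Q (map (\<lambda>i. xs ! \<sigma> i) [m..<m + n]))))
     else 0)"

definition component :: "nat \<Rightarrow> ('g list \<Rightarrow> 'h::zero) \<Rightarrow> ('g list \<Rightarrow> 'h)" where
  "component n F = (\<lambda>xs. if length xs = n then F xs else 0)"

text \<open>
  The biadditive extension of \<^const>\<open>cup\<close> to the direct sum over the degrees \<open>n \<ge> 1\<close>. On lists of
  length \<open>N\<close> only the pairs of degrees \<open>m, N - m \<ge> 1\<close> contribute.
\<close>

definition cup_bracket ::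
  "('k::field \<Rightarrow> 'h::ab_group_add \<Rightarrow> 'h) \<Rightarrow> ('h \<Rightarrow> 'h \<Rightarrow> 'h) \<Rightarrow> ('h \<Rightarrow> 'h)
    \<Rightarrow> ('g list \<Rightarrow> 'h) \<Rightarrow> ('g list \<Rightarrow> 'h) \<Rightarrow> ('g list \<Rightarrow> 'h)" where
  "cup_bracket scale\<^sub>h bracket\<^sub>h \<beta> F G = (\<lambda>xs.
     \<Sum>m\<in>{1..<length xs}.
       cup scale\<^sub>h bracket\<^sub>h \<beta> m (length xs - m) (component m F) (component (length xs - m) G) xs)"

lemma cup_bracket_homogeneous:
  fixes scale\<^sub>g :: "'k::field_char_0 \<Rightarrow> 'g::ab_group_add \<Rightarrow> 'g"
    and scale\<^sub>h :: "'k \<Rightarrow> 'h::ab_group_add \<Rightarrow> 'h"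
  assumes "hom_lie_algebra scale\<^sub>h bracket\<^sub>h \<beta>"
    and "m \<ge> 1" "n \<ge> 1"
    and P: "P \<in> hom_cochains scale\<^sub>g \<alpha> scale\<^sub>h \<beta> m"
    and Q: "Q \<in> hom_cochains scale\<^sub>g \<alpha> scale\<^sub>h \<beta> n"
  shows "cup_bracket scale\<^sub>h bracket\<^sub>h \<beta> P Q = cup scale\<^sub>h bracket\<^sub>h \<beta> m n P Q"
proof
  fix xs :: "'g list"
  interpret hom_lie_algebra scale\<^sub>h bracket\<^sub>h \<beta> by fact
  have b0: "(\<beta> ^^ k) 0 = 0" for k
    using module_hom.zero[OF linear_twist[unfolded linear_iff_module_hom]] by (induction k) auto
  have l0: "bracket\<^sub>h 0 y = 0" and r0: "bracket\<^sub>h y 0 = 0" for y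
    using module_hom.zero[OF linear_bracket_left[unfolded linear_iff_module_hom]]
      module_hom.zero[OF linear_bracket_right[unfolded linear_iff_module_hom]] by auto
  have comp: "component k F = (if k = l then F else (\<lambda>_. 0))"
    if "F \<in> hom_cochains scale\<^sub>g \<alpha> scale\<^sub>h \<beta> l" for F k l
    using that by (auto simp: component_def hom_cochains_def alternating_maps_def)
  have zero: "cup scale\<^sub>h bracket\<^sub>h \<beta> k l (component k P) (component l Q) xs = 0"
    if "k \<noteq> m \<or> l \<noteq> n" for k l
    using that by (auto simp: cup_def comp[OF P] comp[OF Q] b0 l0 r0)
  show "cup_bracket scale\<^sub>h bracket\<^sub>h \<beta> P Q xs = cup scale\<^sub>h bracket\<^sub>h \<beta> m n P Q xs"
  proof (cases "length xs = m + n")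
    case True
    have "cup_bracket scale\<^sub>h bracket\<^sub>h \<beta> P Q xs
      = (\<Sum>k\<in>{m}. cup scale\<^sub>h bracket\<^sub>h \<beta> k (length xs - k)
          (component k P) (component (length xs - k) Q) xs)"
      unfolding cup_bracket_def
      by (rule sum.mono_neutral_right) (use True assms(2,3) zero in auto)
    then show ?thesis using True by (simp add: comp[OF P] comp[OF Q])
  next
    case False
    have "cup_bracket scale\<^sub>h bracket\<^sub>h \<beta> P Q xs = 0"
      unfolding cup_bracket_def
      by (intro sum.neutral ballI zero) (use False in auto)
    then show ?thesis using False by (simp add: cup_def)
  qed
qed

end

theory Submission
  imports Defs "HOL-Library.Infinite_Set"
begin

text \<open>
  Over a field of characteristic \<open>0\<close> the sum over shuffles is a normalised sum over all permutations.
  Every permutation of \<open>m + n\<close> positions is, in exactly one way, a shuffle composed with a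
  permutation of the first \<open>m\<close> and one of the last \<open>n\<close> positions
  (\<open>bij_betw_shuffle_decomposition\<close>), and the alternating maps \<open>P\<close> and \<open>Q\<close> turn the latter two into
  their signs. Hence \<open>m! n! [P,Q]\<close> is the full alternation of the function
  \<open>ys \<mapsto> [\<beta>\<^sup>n\<^sup>-\<^sup>1 P(first m), \<beta>\<^sup>m\<^sup>-\<^sup>1 Q(last n)]\<close> (\<open>cup_conv_alternation\<close>).

  In this form the graded identities become pointwise identities in the target. A full alternation
  only picks up a sign when its integrand is precomposed with a permutation, the rotation that
  exchanges a block of length \<open>m\<close> with a block of length \<open>n\<close> has sign \<open>(-1)\<^sup>m\<^sup>n\<close>, and an inner
  alternation is absorbed by an outer one at the price of a factorial (\<open>alternation_nested\<close>). So the
  bracket is an alternating map, graded skew-symmetry is skew-symmetry of the target bracket, and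
  \<open>p! q! r! [P,[Q,R]]\<close> is the alternation of
  \<open>[\<beta>(a), [b, c]]\<close> with \<open>a = \<beta>\<^sup>q\<^sup>+\<^sup>r\<^sup>-\<^sup>2 P(\<dots>)\<close>, \<open>b = \<beta>\<^sup>p\<^sup>+\<^sup>r\<^sup>-\<^sup>2 Q(\<dots>)\<close>,
  \<open>c = \<beta>\<^sup>p\<^sup>+\<^sup>q\<^sup>-\<^sup>2 R(\<dots>)\<close> (\<open>cup_cup_conv_alternation\<close>): multiplicativity of \<open>\<beta>\<close> moves the outer
  power into the inner bracket, and the powers in the definition are exactly those that make
  \<open>a, b, c\<close> the same three elements, up to a rotation of the arguments, in all three cyclic
  arrangements. The Hom-Jacobi identity for \<open>a, b, c\<close> then gives the cyclic form of the graded
  Jacobi identity (\<open>cup_jacobi_cyclic\<close>), which skew-symmetry turns into the Leibniz form.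
\<close>

section \<open>Block permutations and shuffles\<close>

lemma permute_list_initial_block:
  assumes "\<pi> permutes {..<m}" "length ys = m + n"
  shows "permute_list \<pi> ys = permute_list \<pi> (take m ys) @ drop m ys"
proof (rule nth_equalityI)
  fix i assume i: "i < length (permute_list \<pi> ys)"
  have p: "\<pi> permutes {..<length ys}" "\<pi> permutes {..<length (take m ys)}"
    using assms by (auto intro: permutes_subset)
  have "\<pi> i < m" if "i < m"
    using permutes_in_image[OF assms(1), of i] that by auto
  then show "permute_list \<pi> ys ! i = (permute_list \<pi> (take m ys) @ drop m ys) ! i"
    using i assms p permutes_not_in[OF assms(1), of i]
    by (auto simp: permute_list_nth nth_append)
qed (use assms in simp)

lemma bij_betw_final_block:
  fixes m n :: nat
  shows "bij_betw (map_permutation {..<n} ((+) m)) {\<rho>. \<rho> permutes {..<n}} {\<rho>. \<rho> permutes {m..<m + n}}"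
proof (rule bij_betw_byWitness[where f' = "map_permutation {m..<m + n} (\<lambda>i. i - m)"])
  have b: "bij_betw ((+) m) {..<n} {m..<m + n}" for m n :: nat
    by (rule bij_betw_byWitness[where f' = "\<lambda>i. i - m"]) auto
  have b': "bij_betw (\<lambda>i. i - m) {m..<m + n} {..<n}" for m n :: nat
    by (rule bij_betw_byWitness[where f' = "(+) m"]) auto
  show "\<forall>\<rho>\<in>{\<rho>. \<rho> permutes {..<n}}.
      map_permutation {m..<m + n} (\<lambda>i. i - m) (map_permutation {..<n} ((+) m) \<rho>) = \<rho>"
    using map_permutation_compose_inv[OF b] by auto
  show "\<forall>\<rho>\<in>{\<rho>. \<rho> permutes {m..<m + n}}.
      map_permutation {..<n} ((+) m) (map_permutation {m..<m + n} (\<lambda>i. i - m) \<rho>) = \<rho>"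
    using map_permutation_compose_inv[OF b'] by auto
  show "map_permutation {..<n} ((+) m) ` {\<rho>. \<rho> permutes {..<n}} \<subseteq> {\<rho>. \<rho> permutes {m..<m + n}}"
    using map_permutation_permutes[OF b] by auto
  show "map_permutation {m..<m + n} (\<lambda>i. i - m) ` {\<rho>. \<rho> permutes {m..<m + n}} \<subseteq> {\<rho>. \<rho> permutes {..<n}}"
    using map_permutation_permutes[OF b'] by auto
qed

lemma permute_list_final_block:
  assumes "\<rho> permutes {..<n}" "length ys = m + n"
  shows "permute_list (map_permutation {..<n} ((+) m) \<rho>) ys = take m ys @ permute_list \<rho> (drop m ys)"
    (is "permute_list ?\<rho> ys = _")
proof (rule nth_equalityI)
  have perm: "?\<rho> permutes {m..<m + n}"
    using bij_betw_apply[OF bij_betw_final_block, of \<rho> n m] assms(1) by simp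
  fix i assume i: "i < length (permute_list ?\<rho> ys)"
  have p: "?\<rho> permutes {..<length ys}" "\<rho> permutes {..<length (drop m ys)}"
    using assms perm by (auto intro: permutes_subset)
  show "permute_list ?\<rho> ys ! i = (take m ys @ permute_list \<rho> (drop m ys)) ! i"
  proof (cases "i < m")
    case True
    then show ?thesis using i p assms permutes_not_in[OF perm, of i]
      by (auto simp: permute_list_nth nth_append)
  next
    case False
    then have "?\<rho> i = m + \<rho> (i - m)" "i - m < n"
      using map_permutation_apply[of "(+) m" "{..<n}" "i - m" \<rho>] i assms by auto
    then show ?thesis using i p assms False permutes_in_image[OF assms(1), of "i - m"]
      by (auto simp: permute_list_nth nth_append)
  qed
qed (use assms in simp)

text \<open>
  A strictly increasing function on a finite interval lists its image in sorted order. This makes a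
  shuffle recoverable from its image of the first block.
\<close>

lemma strict_mono_on_image_unique:
  fixes f g :: "nat \<Rightarrow> 'a::linorder"
  assumes "strict_mono_on {m..<n} f" "strict_mono_on {m..<n} g"
    and "f ` {m..<n} = g ` {m..<n}" "i \<in> {m..<n}"
  shows "f i = g i"
proof -
  have srt: "sorted_wrt (<) (map h [m..<n])" if "strict_mono_on {m..<n} h" for h :: "nat \<Rightarrow> 'a"
    unfolding sorted_wrt_map
    by (rule sorted_wrt_mono_rel[OF _ sorted_wrt_upt]) (use that in \<open>auto simp: strict_mono_on_def\<close>)
  have "map f [m..<n] = map g [m..<n]"
    by (rule strict_sorted_equal) (use srt assms in auto)
  then show ?thesis using assms(4) by (simp add: map_eq_conv)
qed

lemma sorting_permutation:
  fixes f :: "nat \<Rightarrow> 'a::wellorder"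
  assumes "inj_on f {m..<n}"
  obtains \<pi> where "\<pi> permutes {m..<n}" "strict_mono_on {m..<n} (f \<circ> \<pi>)"
proof (cases "m \<le> n")
  case True
  have "card (f ` {m..<n}) = n - m"
    using assms by (simp add: card_image)
  then obtain h where h: "bij_betw h {..<n - m} (f ` {m..<n})" "strict_mono_on {..<n - m} h"
    using ex_bij_betw_strict_mono_card[of "f ` {m..<n}"] by auto
  define s where "s i = h (i - m)" for i
  have b': "bij_betw (\<lambda>i. i - m) {m..<n} {..<n - m}"
    by (rule bij_betw_byWitness[where f' = "(+) m"]) auto
  have s: "bij_betw s {m..<n} (f ` {m..<n})"
    unfolding s_def using bij_betw_trans[OF b' h(1)] by (simp add: comp_def)
  have s_mono: "strict_mono_on {m..<n} s"
    unfolding s_def by (rule strict_mono_onI, rule strict_mono_onD[OF h(2)]) auto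
  define \<pi> where "\<pi> i = (if i \<in> {m..<n} then inv_into {m..<n} f (s i) else i)" for i
  have "bij_betw (inv_into {m..<n} f \<circ> s) {m..<n} {m..<n}"
    by (rule bij_betw_trans[OF s bij_betw_inv_into[OF inj_on_imp_bij_betw[OF assms]]])
  moreover have "(inv_into {m..<n} f \<circ> s) i = \<pi> i" if "i \<in> {m..<n}" for i
    using that by (simp add: \<pi>_def)
  ultimately have "bij_betw \<pi> {m..<n} {m..<n}"
    using bij_betw_cong[of "{m..<n}" "inv_into {m..<n} f \<circ> s" \<pi> "{m..<n}"] by blast
  then have "\<pi> permutes {m..<n}"
    by (rule bij_imp_permutes) (auto simp: \<pi>_def)
  moreover have "(f \<circ> \<pi>) i = s i" if "i \<in> {m..<n}" for i
    using that f_inv_into_f[OF bij_betw_apply[OF s that]] by (simp add: \<pi>_def)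
  then have "strict_mono_on {m..<n} (f \<circ> \<pi>)"
    using s_mono by (auto simp: strict_mono_on_def)
  ultimately show ?thesis by (rule that)
qed (use that[of id] in auto)

text \<open>
  Sorting the values of a permutation separately on the two blocks produces the shuffle; it is
  unique because permutations inside the blocks leave the images of the blocks unchanged.
\<close>

lemma bij_betw_shuffle_decomposition:
  "bij_betw (\<lambda>(s, \<pi>, \<rho>). s \<circ> (\<pi> \<circ> \<rho>))
     (Sh m n \<times> {\<pi>. \<pi> permutes {..<m}} \<times> {\<rho>. \<rho> permutes {m..<m + n}})
     {\<sigma>. \<sigma> permutes {..<m + n}}"
  unfolding bij_betw_def
proof
  have in_block: "\<pi> permutes {..<m + n}" if "\<pi> permutes {..<m} \<or> \<pi> permutes {m..<m + n}" for \<pi>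
    using that by (auto intro: permutes_subset)
  show "inj_on (\<lambda>(s, \<pi>, \<rho>). s \<circ> (\<pi> \<circ> \<rho>))
     (Sh m n \<times> {\<pi>. \<pi> permutes {..<m}} \<times> {\<rho>. \<rho> permutes {m..<m + n}})"
  proof (rule inj_onI)
    fix t t'
    assume t: "t \<in> Sh m n \<times> {\<pi>. \<pi> permutes {..<m}} \<times> {\<rho>. \<rho> permutes {m..<m + n}}"
      "t' \<in> Sh m n \<times> {\<pi>. \<pi> permutes {..<m}} \<times> {\<rho>. \<rho> permutes {m..<m + n}}"
      and eq_t: "(\<lambda>(s, \<pi>, \<rho>). s \<circ> (\<pi> \<circ> \<rho>)) t = (\<lambda>(s, \<pi>, \<rho>). s \<circ> (\<pi> \<circ> \<rho>)) t'"
    obtain s \<pi> \<rho> where ts: "t = (s, \<pi>, \<rho>)" by (cases t)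
    obtain s' \<pi>' \<rho>' where ts': "t' = (s', \<pi>', \<rho>')" by (cases t')
    from t have s: "s \<in> Sh m n" "s' \<in> Sh m n"
      and p: "\<pi> permutes {..<m}" "\<pi>' permutes {..<m}"
      and r: "\<rho> permutes {m..<m + n}" "\<rho>' permutes {m..<m + n}"
      by (simp_all add: ts ts')
    have eq: "s \<circ> (\<pi> \<circ> \<rho>) = s' \<circ> (\<pi>' \<circ> \<rho>')"
      using eq_t by (simp only: ts ts' prod.case)
    have first: "(\<pi> \<circ> \<rho>) ` {..<m} = {..<m}"
      if "\<pi> permutes {..<m}" "\<rho> permutes {m..<m + n}" for \<pi> \<rho>
    proof -
      have "\<rho> ` {..<m} = {..<m}" using permutes_not_in[OF that(2)] by force
      then show ?thesis using permutes_image[OF that(1)] by (metis image_comp)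
    qed
    have second: "(\<pi> \<circ> \<rho>) ` {m..<m + n} = {m..<m + n}"
      if "\<pi> permutes {..<m}" "\<rho> permutes {m..<m + n}" for \<pi> \<rho>
    proof -
      have "\<pi> ` {m..<m + n} = {m..<m + n}" using permutes_not_in[OF that(1)] by force
      then show ?thesis using permutes_image[OF that(2)] by (metis image_comp)
    qed
    have "s ` {..<m} = s' ` {..<m}" "s ` {m..<m + n} = s' ` {m..<m + n}"
      using eq first[OF p(1) r(1)] first[OF p(2) r(2)] second[OF p(1) r(1)] second[OF p(2) r(2)]
      by (metis image_comp)+
    then have "s i = s' i" if "i < m + n" for i
      using strict_mono_on_image_unique[of 0 m s s' i] strict_mono_on_image_unique[of m "m + n" s s' i]
        s that by (cases "i < m") (auto simp: Sh_def lessThan_atLeast0)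
    moreover have "s i = s' i" if "\<not> i < m + n" for i
      using s that permutes_not_in[of s "{..<m + n}" i] permutes_not_in[of s' "{..<m + n}" i]
      by (simp add: Sh_def)
    ultimately have ss: "s = s'" by blast
    have "inj s" using s by (auto simp: Sh_def permutes_inj)
    then have pr: "\<pi> \<circ> \<rho> = \<pi>' \<circ> \<rho>'"
      using fun_cong[OF eq] by (intro ext) (simp add: ss inj_eq)
    have "\<rho> i = \<rho>' i" for i
    proof (cases "i \<in> {m..<m + n}")
      case True
      then have "\<rho> i \<in> {m..<m + n}" "\<rho>' i \<in> {m..<m + n}"
        using r by (simp_all only: permutes_in_image)
      then show ?thesis
        using fun_cong[OF pr, of i] permutes_not_in[OF p(1), of "\<rho> i"] permutes_not_in[OF p(2), of "\<rho>' i"]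
        by auto
    qed (use r in \<open>simp add: permutes_not_in\<close>)
    then have rr: "\<rho> = \<rho>'" by blast
    moreover have "\<pi> = \<pi>'"
    proof
      fix i
      obtain j where "i = \<rho>' j" using permutes_surj[OF r(2)] by (elim surjE)
      then show "\<pi> i = \<pi>' i" using fun_cong[OF pr, of j] by (simp add: rr)
    qed
    ultimately show "t = t'" using ss by (simp add: ts ts')
  qed
  show "(\<lambda>(s, \<pi>, \<rho>). s \<circ> (\<pi> \<circ> \<rho>)) `
     (Sh m n \<times> {\<pi>. \<pi> permutes {..<m}} \<times> {\<rho>. \<rho> permutes {m..<m + n}}) = {\<sigma>. \<sigma> permutes {..<m + n}}"
  proof (intro equalityI subsetI)
    fix \<sigma> assume "\<sigma> \<in> {\<sigma>. \<sigma> permutes {..<m + n}}"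
    then have \<sigma>: "\<sigma> permutes {..<m + n}" by simp
    then have inj: "inj_on \<sigma> A" for A by (rule permutes_inj_on)
    obtain \<pi> where p: "\<pi> permutes {0..<m}" "strict_mono_on {0..<m} (\<sigma> \<circ> \<pi>)"
      using sorting_permutation[OF inj] by blast
    obtain \<rho> where r: "\<rho> permutes {m..<m + n}" "strict_mono_on {m..<m + n} (\<sigma> \<circ> \<rho>)"
      using sorting_permutation[OF inj] by blast
    have p': "\<pi> permutes {..<m}" using p(1) by (simp add: lessThan_atLeast0)
    define s where "s = \<sigma> \<circ> (\<rho> \<circ> \<pi>)"
    have "s permutes {..<m + n}"
      unfolding s_def using in_block p' r(1) \<sigma> by (intro permutes_compose) auto
    moreover have "s i = (\<sigma> \<circ> \<pi>) i" if "i < m" for i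
      using permutes_in_image[OF p', of i] permutes_not_in[OF r(1), of "\<pi> i"] that by (auto simp: s_def)
    then have "strict_mono_on {..<m} s"
      using p(2) by (auto simp: strict_mono_on_def)
    moreover have "s i = (\<sigma> \<circ> \<rho>) i" if "i \<in> {m..<m + n}" for i
      using permutes_not_in[OF p', of i] that by (auto simp: s_def)
    then have "strict_mono_on {m..<m + n} s"
      using r(2) by (auto simp: strict_mono_on_def)
    ultimately have "s \<in> Sh m n" by (simp add: Sh_def)
    moreover have "\<sigma> = s \<circ> (inv \<pi> \<circ> inv \<rho>)"
      using permutes_inverses(1)[OF p'] permutes_inverses(1)[OF r(1)] by (auto simp: s_def fun_eq_iff)
    ultimately show "\<sigma> \<in> (\<lambda>(s, \<pi>, \<rho>). s \<circ> (\<pi> \<circ> \<rho>)) `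
       (Sh m n \<times> {\<pi>. \<pi> permutes {..<m}} \<times> {\<rho>. \<rho> permutes {m..<m + n}})"
      using permutes_inv[OF p'] permutes_inv[OF r(1)]
      by (intro image_eqI[of _ _ "(s, inv \<pi>, inv \<rho>)"]) auto
  next
    fix \<sigma> assume "\<sigma> \<in> (\<lambda>(s, \<pi>, \<rho>). s \<circ> (\<pi> \<circ> \<rho>)) `
     (Sh m n \<times> {\<pi>. \<pi> permutes {..<m}} \<times> {\<rho>. \<rho> permutes {m..<m + n}})"
    then show "\<sigma> \<in> {\<sigma>. \<sigma> permutes {..<m + n}}"
      using in_block by (auto simp: Sh_def intro!: permutes_compose)
  qed
qed

text \<open>
  The cycle of length \<open>N + 1\<close> is the product of a cycle of length \<open>N\<close> and an adjacent
  transposition.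
\<close>

lemma rotate1_permutation:
  "\<exists>\<tau>. \<tau> permutes {..<Suc N} \<and> sign \<tau> = (-1) ^ N \<and>
     (\<forall>xs :: 'a list. length xs = Suc N \<longrightarrow> permute_list \<tau> xs = rotate1 xs)"
proof -
  define \<tau> :: "nat \<Rightarrow> nat \<Rightarrow> nat"
    where "\<tau> N i = (if i < N then Suc i else if i = N then 0 else i)" for N i
  have step: "\<tau> (Suc N) = \<tau> N \<circ> transpose N (Suc N)" for N
    by (auto simp: fun_eq_iff \<tau>_def transpose_def)
  have "\<tau> N permutes {..<Suc N} \<and> sign (\<tau> N) = (-1) ^ N"
  proof (induction N)
    case 0
    have "\<tau> 0 = id" by (auto simp: \<tau>_def)
    then show ?case by (simp add: permutes_id[unfolded id_def])
  next
    case (Suc N)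
    have t: "transpose N (Suc N) permutes {..<Suc (Suc N)}" by (rule permutes_swap_id) auto
    from Suc have p: "\<tau> N permutes {..<Suc (Suc N)}" by (auto intro: permutes_subset)
    have "sign (\<tau> (Suc N)) = sign (\<tau> N) * sign (transpose N (Suc N))"
      unfolding step by (intro sign_compose permutes_imp_permutation[OF _ p] permutation_swap_id) simp
    then show ?case using Suc permutes_compose[OF t p] by (simp add: step sign_swap_id del: o_apply comp_apply)
  qed
  moreover have "permute_list (\<tau> N) xs = rotate1 xs" if "length xs = Suc N" for xs :: "'a list"
    using that calculation
    by (intro nth_equalityI) (auto simp: permute_list_nth nth_rotate1 \<tau>_def mod_Suc)
  ultimately show ?thesis by blast
qed

text \<open>
  Rotation by \<open>m\<close> is the \<open>m\<close>-th power of a cycle of length \<open>m + n\<close>, hence has sign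
  \<open>(-1)\<close> to the power \<open>m (m + n - 1)\<close>, which has the parity of \<open>m n\<close>. It exchanges an initial block
  of length \<open>m\<close> with a final block of length \<open>n\<close> and is the source of the signs in the graded
  identities.
\<close>

lemma rotate_permutation:
  "\<exists>\<tau>. \<tau> permutes {..<m + n} \<and> sign \<tau> = (-1) ^ (m * n) \<and>
     (\<forall>xs :: 'a list. length xs = m + n \<longrightarrow> permute_list \<tau> xs = rotate m xs)"
proof (cases "m + n")
  case 0
  then show ?thesis by (intro exI[of _ id]) auto
next
  case (Suc N)
  obtain \<tau> where \<tau>: "\<tau> permutes {..<Suc N}" "sign \<tau> = (-1) ^ N"
    and rot: "\<And>xs :: 'a list. length xs = Suc N \<Longrightarrow> permute_list \<tau> xs = rotate1 xs"
    using rotate1_permutation by blast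
  have pow: "(\<tau> ^^ k) permutes {..<Suc N} \<and> sign (\<tau> ^^ k) = (-1) ^ (k * N) \<and>
     (\<forall>xs :: 'a list. length xs = Suc N \<longrightarrow> permute_list (\<tau> ^^ k) xs = rotate k xs)" for k
  proof (induction k)
    case (Suc k)
    have "permutation \<tau>" "permutation (\<tau> ^^ k)"
      using Suc \<tau>(1) by (auto intro: permutes_imp_permutation[rotated])
    then have "sign (\<tau> ^^ Suc k) = (-1) ^ (Suc k * N)"
      using \<tau>(2) Suc by (simp add: sign_compose power_add)
    moreover have "permute_list (\<tau> ^^ Suc k) xs = rotate (Suc k) xs" if "length xs = Suc N" for xs :: "'a list"
    proof -
      have "permute_list (\<tau> ^^ Suc k) xs = permute_list \<tau> (permute_list (\<tau> ^^ k) xs)"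
        using permute_list_compose[of \<tau> xs "\<tau> ^^ k"] \<tau>(1) that by (simp add: funpow_Suc_right del: funpow.simps)
      then show ?thesis using Suc rot that by simp
    qed
    moreover have "(\<tau> ^^ Suc k) permutes {..<Suc N}"
      unfolding funpow.simps using Suc \<tau>(1) by (intro permutes_compose) auto
    ultimately show ?case by blast
  qed (auto simp: permutes_id[unfolded id_def])
  have "even (m * N) = even (m * n)"
    using Suc by (cases "even m") (auto, presburger+)
  then have "(-1) ^ (m * N) = ((-1) ^ (m * n) :: int)" by (simp add: uminus_power_if)
  then show ?thesis using pow[of m] Suc by auto
qed

section \<open>Alternating multilinear maps\<close>

definition multilinear ::
  "('k::field \<Rightarrow> 'g::ab_group_add \<Rightarrow> 'g) \<Rightarrow> ('k \<Rightarrow> 'h::ab_group_add \<Rightarrow> 'h) \<Rightarrow> nat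
    \<Rightarrow> ('g list \<Rightarrow> 'h) \<Rightarrow> bool" where
  "multilinear scale\<^sub>g scale\<^sub>h n f \<longleftrightarrow>
     (\<forall>xs i. length xs = n \<and> i < n \<longrightarrow>
        Vector_Spaces.linear scale\<^sub>g scale\<^sub>h (\<lambda>x. f (xs[i := x])))"

lemma permute_list_transpose:
  assumes "i < length xs" "j < length xs"
  shows "permute_list (transpose i j) xs = xs[i := xs ! j, j := xs ! i]"
  using assms permutes_swap_id[of i "{..<length xs}" j]
  by (intro nth_equalityI) (auto simp: permute_list_nth nth_list_update transpose_def)

lemma permute_list_update:
  assumes "\<sigma> permutes {..<length xs}" "i < length xs"
  shows "permute_list \<sigma> (xs[i := x]) = (permute_list \<sigma> xs)[inv \<sigma> i := x]"
proof (rule nth_equalityI)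
  fix j assume j: "j < length (permute_list \<sigma> (xs[i := x]))"
  have "\<sigma> j < length xs" using permutes_in_image[OF assms(1), of j] j by auto
  then show "permute_list \<sigma> (xs[i := x]) ! j = (permute_list \<sigma> xs)[inv \<sigma> i := x] ! j"
    using j assms permutes_inv_eq[OF assms(1), of i j]
    by (auto simp: permute_list_nth nth_list_update)
qed simp

text \<open>
  Polarisation: expand \<open>f(\<dots>, a + b, \<dots>, a + b, \<dots>) = 0\<close>.
\<close>

lemma alternating_swap:
  assumes f: "f \<in> alternating_maps scale\<^sub>g scale\<^sub>h n" and xs: "length xs = n"
    and ij: "i < n" "j < n" "i \<noteq> j"
  shows "f (permute_list (transpose i j) xs) = - f xs"
proof -
  define g where "g a b = f (xs[i := a, j := b])" for a b
  have lin: "Vector_Spaces.linear scale\<^sub>g scale\<^sub>h (\<lambda>x. f (ys[k := x]))"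
    if "length ys = n" "k < n" for ys k
    using f that by (auto simp: alternating_maps_def)
  have right: "g a (b + c) = g a b + g a c" for a b c
    using lin[of "xs[i := a]" j] xs ij by (simp add: g_def Vector_Spaces.linear_iff)
  have left: "g (a + b) c = g a c + g b c" for a b c
    using lin[of "xs[j := c]" i] xs ij by (simp add: g_def Vector_Spaces.linear_iff list_update_swap)
  have diag: "g a a = 0" for a
  proof -
    have "\<not> distinct (xs[i := a, j := a])"
      using xs ij nth_eq_iff_index_eq[of "xs[i := a, j := a]" i j] by (auto simp: nth_list_update)
    then show ?thesis using f xs by (auto simp: g_def alternating_maps_def)
  qed
  have "g (xs ! i + xs ! j) (xs ! i + xs ! j) = g (xs ! i) (xs ! j) + g (xs ! j) (xs ! i)"
    unfolding left right by (simp add: diag)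
  then have "g (xs ! j) (xs ! i) = - g (xs ! i) (xs ! j)"
    unfolding diag by (simp add: eq_neg_iff_add_eq_0 add.commute)
  then show ?thesis using xs ij by (simp add: g_def permute_list_transpose)
qed

text \<open>
  The Hom-Lie algebra in which cochains take their values, with parameter names that leave \<open>\<alpha>\<close> free
  for the twist of the source.
\<close>

locale hom_lie_coefficients = hom_lie_algebra scale\<^sub>h bracket\<^sub>h \<beta>
  for scale\<^sub>h :: "'k::field_char_0 \<Rightarrow> 'h::ab_group_add \<Rightarrow> 'h"
    and bracket\<^sub>h :: "'h \<Rightarrow> 'h \<Rightarrow> 'h"
    and \<beta> :: "'h \<Rightarrow> 'h"
begin

lemma linear_twist_power: "Vector_Spaces.linear scale\<^sub>h scale\<^sub>h (\<beta> ^^ k)"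
  using linear_twist vector_space_axioms by (induction k) (auto simp: Vector_Spaces.linear_iff)

lemma twist_power_simps:
  "(\<beta> ^^ k) (x + y) = (\<beta> ^^ k) x + (\<beta> ^^ k) y"
  "(\<beta> ^^ k) (scale\<^sub>h c x) = scale\<^sub>h c ((\<beta> ^^ k) x)"
  "(\<beta> ^^ k) (\<Sum>i\<in>A. f i) = (\<Sum>i\<in>A. (\<beta> ^^ k) (f i))"
  using linear_twist_power[of k]
  by (auto simp: Vector_Spaces.linear_iff module_hom.sum[OF linear_twist_power[unfolded linear_iff_module_hom]])

lemma bracket_simps:
  "bracket\<^sub>h (x + y) z = bracket\<^sub>h x z + bracket\<^sub>h y z"
  "bracket\<^sub>h z (x + y) = bracket\<^sub>h z x + bracket\<^sub>h z y"
  "bracket\<^sub>h (scale\<^sub>h c x) z = scale\<^sub>h c (bracket\<^sub>h x z)"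
  "bracket\<^sub>h z (scale\<^sub>h c x) = scale\<^sub>h c (bracket\<^sub>h z x)"
  "bracket\<^sub>h z (\<Sum>i\<in>A. f i) = (\<Sum>i\<in>A. bracket\<^sub>h z (f i))"
  using linear_bracket_left[of z] linear_bracket_right[of z]
  by (auto simp: Vector_Spaces.linear_iff module_hom.sum[OF linear_bracket_right[unfolded linear_iff_module_hom]])

lemma twist_power_bracket: "(\<beta> ^^ k) (bracket\<^sub>h x y) = bracket\<^sub>h ((\<beta> ^^ k) x) ((\<beta> ^^ k) y)"
  by (induction k) (auto simp: multiplicative)

lemma sign_scale_cancel [simp]:
  "scale\<^sub>h (of_int (sign \<sigma>)) (scale\<^sub>h (of_int (sign \<sigma>)) x) = x"
  by (simp flip: of_int_mult)

lemma alternating_permute: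
  assumes f: "f \<in> alternating_maps scale\<^sub>g scale\<^sub>h n"
    and \<sigma>: "\<sigma> permutes {..<n}" and xs: "length xs = n"
  shows "f (permute_list \<sigma> xs) = scale\<^sub>h (of_int (sign \<sigma>)) (f xs)"
proof -
  have "finite {..<n}" by simp
  with \<sigma> show ?thesis using xs
  proof (induction \<sigma> arbitrary: xs rule: permutes_induct)
    case (swap i j \<sigma>)
    have perm: "\<sigma> permutes {..<length xs}" "permutation \<sigma>" using swap by (auto intro: permutes_imp_permutation[rotated])
    have "f (permute_list (transpose i j \<circ> \<sigma>) xs) = f (permute_list \<sigma> (permute_list (transpose i j) xs))"
      using permute_list_compose[OF perm(1)] by simp
    also have "\<dots> = scale\<^sub>h (of_int (sign \<sigma>)) (f (permute_list (transpose i j) xs))"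
      using swap by simp
    also have "\<dots> = scale\<^sub>h (of_int (sign (transpose i j \<circ> \<sigma>))) (f xs)"
      using alternating_swap[OF f] swap perm
      by (simp add: sign_compose permutation_swap_id sign_swap_id)
    finally show ?case .
  qed simp
qed

section \<open>Alternation over the full symmetric group\<close>

definition alternation :: "nat \<Rightarrow> ('g list \<Rightarrow> 'h) \<Rightarrow> 'g list \<Rightarrow> 'h" where
  "alternation n F xs = (\<Sum>\<sigma> | \<sigma> permutes {..<n}.
     scale\<^sub>h (of_int (sign \<sigma>)) (F (permute_list \<sigma> xs)))"

lemma alternation_cong:
  assumes "\<And>ys. length ys = n \<Longrightarrow> F ys = G ys" "length xs = n"
  shows "alternation n F xs = alternation n G xs"
  using assms by (simp add: alternation_def)

lemma alternation_add:
  "alternation n (\<lambda>ys. F ys + G ys) xs = alternation n F xs + alternation n G xs"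
  by (simp add: alternation_def scale_right_distrib sum.distrib)

lemma alternation_scale:
  "alternation n (\<lambda>ys. scale\<^sub>h c (F ys)) xs = scale\<^sub>h c (alternation n F xs)"
  by (simp add: alternation_def scale_sum_right mult.commute)

lemma alternation_permute_argument:
  assumes \<tau>: "\<tau> permutes {..<n}" and xs: "length xs = n"
  shows "alternation n F (permute_list \<tau> xs) = scale\<^sub>h (of_int (sign \<tau>)) (alternation n F xs)"
proof -
  have "alternation n F xs = (\<Sum>\<sigma> | \<sigma> permutes {..<n}.
      scale\<^sub>h (of_int (sign (\<tau> \<circ> \<sigma>))) (F (permute_list (\<tau> \<circ> \<sigma>) xs)))"
    unfolding alternation_def by (rule setum_permutations_compose_left[OF \<tau>])
  also have "\<dots> = scale\<^sub>h (of_int (sign \<tau>)) (alternation n F (permute_list \<tau> xs))"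
    unfolding alternation_def scale_sum_right
  proof (intro sum.cong refl, clarify)
    fix \<sigma> assume \<sigma>: "\<sigma> permutes {..<n}"
    then have "sign (\<tau> \<circ> \<sigma>) = sign \<tau> * sign \<sigma>"
      using \<tau> by (intro sign_compose permutes_imp_permutation) auto
    then show "scale\<^sub>h (of_int (sign (\<tau> \<circ> \<sigma>))) (F (permute_list (\<tau> \<circ> \<sigma>) xs)) =
      scale\<^sub>h (of_int (sign \<tau>)) (scale\<^sub>h (of_int (sign \<sigma>)) (F (permute_list \<sigma> (permute_list \<tau> xs))))"
      using permute_list_compose[of \<sigma> xs \<tau>] \<sigma> xs by simp
  qed
  finally show ?thesis by (simp del: scale_scale)
qed

lemma alternation_permute_integrand:
  assumes \<tau>: "\<tau> permutes {..<n}" and xs: "length xs = n"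
  shows "alternation n (\<lambda>ys. F (permute_list \<tau> ys)) xs
    = scale\<^sub>h (of_int (sign \<tau>)) (alternation n F xs)"
proof -
  have "alternation n F xs = (\<Sum>\<sigma> | \<sigma> permutes {..<n}.
      scale\<^sub>h (of_int (sign (\<sigma> \<circ> \<tau>))) (F (permute_list (\<sigma> \<circ> \<tau>) xs)))"
    unfolding alternation_def by (rule sum_permutations_compose_right[OF \<tau>])
  also have "\<dots> = scale\<^sub>h (of_int (sign \<tau>)) (alternation n (\<lambda>ys. F (permute_list \<tau> ys)) xs)"
    unfolding alternation_def scale_sum_right
  proof (intro sum.cong refl, clarify)
    fix \<sigma> assume \<sigma>: "\<sigma> permutes {..<n}"
    then have "sign (\<sigma> \<circ> \<tau>) = sign \<tau> * sign \<sigma>"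
      using \<tau> by (subst sign_compose) (auto intro: permutes_imp_permutation[rotated])
    then show "scale\<^sub>h (of_int (sign (\<sigma> \<circ> \<tau>))) (F (permute_list (\<sigma> \<circ> \<tau>) xs)) =
      scale\<^sub>h (of_int (sign \<tau>)) (scale\<^sub>h (of_int (sign \<sigma>)) (F (permute_list \<tau> (permute_list \<sigma> xs))))"
      using permute_list_compose[of \<tau> xs \<sigma>] \<tau> xs by simp
  qed
  finally show ?thesis by (simp del: scale_scale)
qed

lemma alternation_rotate:
  fixes xs :: "'g list"
  assumes xs: "length xs = m + n"
  shows "alternation (m + n) (\<lambda>ys. F (rotate m ys)) xs
    = scale\<^sub>h ((-1) ^ (m * n)) (alternation (m + n) F xs)"
proof -
  obtain \<tau> where \<tau>: "\<tau> permutes {..<m + n}" "sign \<tau> = (-1) ^ (m * n)"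
    and rot: "\<And>xs :: 'g list. length xs = m + n \<Longrightarrow> permute_list \<tau> xs = rotate m xs"
    using rotate_permutation[of m n] by blast
  have "alternation (m + n) (\<lambda>ys. F (rotate m ys)) xs
      = alternation (m + n) (\<lambda>ys. F (permute_list \<tau> ys)) xs"
    by (rule alternation_cong[OF _ xs]) (simp add: rot)
  then show ?thesis
    by (simp add: alternation_permute_integrand[OF \<tau>(1) xs] \<tau>(2))
qed

text \<open>
  Transposing two equal entries changes the sign of the alternation but not the arguments, and \<open>2\<close>
  is invertible.
\<close>

lemma alternation_repeated:
  assumes xs: "length xs = n" "\<not> distinct xs"
  shows "alternation n F xs = 0"
proof -
  obtain i j where ij: "i < n" "j < n" "i \<noteq> j" "xs ! i = xs ! j"
    using xs by (auto simp: distinct_conv_nth)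
  have "permute_list (transpose i j) xs = xs"
    using ij xs by (simp add: permute_list_transpose) (metis list_update_id)
  moreover have "transpose i j permutes {..<n}"
    using ij by (intro permutes_swap_id) auto
  ultimately have "alternation n F xs = - alternation n F xs"
    using alternation_permute_argument[of "transpose i j" n xs F] xs ij
    by (simp add: sign_swap_id)
  then have "scale\<^sub>h 2 (alternation n F xs) = 0"
    using scale_left_distrib[of 1 1 "alternation n F xs"] by (simp add: eq_neg_iff_add_eq_0)
  then show ?thesis by simp
qed

lemma multilinear_alternation:
  fixes scale\<^sub>g :: "'k \<Rightarrow> 'g::ab_group_add \<Rightarrow> 'g"
  assumes "vector_space scale\<^sub>g" and F: "multilinear scale\<^sub>g scale\<^sub>h n F"
  shows "multilinear scale\<^sub>g scale\<^sub>h n (alternation n F)"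
  unfolding multilinear_def
proof (intro allI impI, elim conjE)
  fix xs :: "'g list" and i assume xs: "length xs = n" "i < n"
  have "Vector_Spaces.linear scale\<^sub>g scale\<^sub>h (\<lambda>x. F (permute_list \<sigma> (xs[i := x])))"
    if "\<sigma> permutes {..<n}" for \<sigma>
  proof -
    have "inv \<sigma> i < n" using permutes_in_image[OF permutes_inv[OF that], of i] xs by simp
    then show ?thesis using F that xs by (simp add: permute_list_update multilinear_def)
  qed
  then show "Vector_Spaces.linear scale\<^sub>g scale\<^sub>h (\<lambda>x. alternation n F (xs[i := x]))"
    using assms(1) vector_space_axioms
    by (simp add: Vector_Spaces.linear_iff alternation_def sum.distrib scale_right_distrib scale_sum_right mult.commute)
qed

text \<open>
  For each inner permutation \<open>\<tau>\<close>, letting \<open>\<tau>\<close> act on the last \<open>n\<close> entries contributes its sign a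
  second time when it is moved out of the outer alternation. So all \<open>n!\<close> summands of the inner
  alternation contribute equally.
\<close>

lemma alternation_nested:
  fixes xs :: "'g list"
  assumes G: "\<And>as. Vector_Spaces.linear scale\<^sub>h scale\<^sub>h (G as)" and xs: "length xs = m + n"
  shows "alternation (m + n) (\<lambda>ys. G (take m ys) (alternation n H (drop m ys))) xs
    = scale\<^sub>h (fact n) (alternation (m + n) (\<lambda>ys. G (take m ys) (H (drop m ys))) xs)"
proof -
  let ?K = "\<lambda>ys. G (take m ys) (H (drop m ys))"
  let ?\<tau> = "\<lambda>\<tau>. map_permutation {..<n} ((+) m) \<tau>"
  have "alternation (m + n) (\<lambda>ys. G (take m ys) (alternation n H (drop m ys))) xs
    = alternation (m + n) (\<lambda>ys. \<Sum>\<tau> | \<tau> permutes {..<n}.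
        scale\<^sub>h (of_int (sign \<tau>)) (?K (permute_list (?\<tau> \<tau>) ys))) xs"
  proof (rule alternation_cong[OF _ xs])
    fix ys :: "'g list" assume ys: "length ys = m + n"
    have "permute_list (?\<tau> \<tau>) ys = take m ys @ permute_list \<tau> (drop m ys)"
      if "\<tau> permutes {..<n}" for \<tau>
      by (rule permute_list_final_block[OF that ys])
    then have K: "?K (permute_list (?\<tau> \<tau>) ys) = G (take m ys) (H (permute_list \<tau> (drop m ys)))"
      if "\<tau> permutes {..<n}" for \<tau>
      using that ys by simp
    interpret G: module_hom scale\<^sub>h scale\<^sub>h "G (take m ys)"
      using G by (simp only: linear_iff_module_hom)
    show "G (take m ys) (alternation n H (drop m ys)) = (\<Sum>\<tau> | \<tau> permutes {..<n}.
        scale\<^sub>h (of_int (sign \<tau>)) (?K (permute_list (?\<tau> \<tau>) ys)))"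
      unfolding alternation_def G.sum G.scale by (intro sum.cong refl) (simp only: K mem_Collect_eq)
  qed
  also have "\<dots> = (\<Sum>\<tau> | \<tau> permutes {..<n}. scale\<^sub>h (of_int (sign \<tau>))
      (alternation (m + n) (\<lambda>ys. ?K (permute_list (?\<tau> \<tau>) ys)) xs))"
    unfolding alternation_def scale_sum_right
    by (subst sum.swap) (simp add: mult.commute)
  also have "\<dots> = (\<Sum>\<tau> | \<tau> permutes {..<n}. alternation (m + n) ?K xs)"
  proof (intro sum.cong refl, clarify)
    fix \<tau> assume \<tau>: "\<tau> permutes {..<n}"
    then have "?\<tau> \<tau> permutes {m..<m + n}"
      using bij_betw_apply[OF bij_betw_final_block] by blast
    then have "?\<tau> \<tau> permutes {..<m + n}" by (auto intro: permutes_subset)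
    moreover have "sign (?\<tau> \<tau>) = sign \<tau>" using \<tau> by (simp add: sign_map_permutation)
    ultimately show "scale\<^sub>h (of_int (sign \<tau>))
        (alternation (m + n) (\<lambda>ys. ?K (permute_list (?\<tau> \<tau>) ys)) xs) = alternation (m + n) ?K xs"
      using alternation_permute_integrand[of "?\<tau> \<tau>" "m + n" xs ?K] xs
      by (simp del: scale_scale)
  qed
  also have "\<dots> = scale\<^sub>h (fact n) (alternation (m + n) ?K xs)"
    by (simp add: sum_constant_scale card_permutations[OF refl] del: sum_constant)
  finally show ?thesis .
qed

section \<open>The cup product bracket as an alternation\<close>

definition juxtaposition :: "nat \<Rightarrow> nat \<Rightarrow> ('g list \<Rightarrow> 'h) \<Rightarrow> ('g list \<Rightarrow> 'h) \<Rightarrow> 'g list \<Rightarrow> 'h" where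
  "juxtaposition m n P Q ys =
     bracket\<^sub>h ((\<beta> ^^ (n - 1)) (P (take m ys))) ((\<beta> ^^ (m - 1)) (Q (drop m ys)))"

lemma cup_conv_juxtaposition:
  assumes "length xs = m + n"
  shows "cup scale\<^sub>h bracket\<^sub>h \<beta> m n P Q xs = (\<Sum>\<sigma>\<in>Sh m n.
    scale\<^sub>h (of_int (sign \<sigma>)) (juxtaposition m n P Q (permute_list \<sigma> xs)))"
  using assms by (simp add: cup_def juxtaposition_def permute_list_def take_map drop_map)

text \<open>
  The signed summands of the alternation are constant on the cosets of the group of block permutations, of
  which the shuffles are representatives.
\<close>

lemma juxtaposition_block_permute:
  assumes P: "P \<in> alternating_maps scale\<^sub>g scale\<^sub>h m" and Q: "Q \<in> alternating_maps scale\<^sub>g scale\<^sub>h n"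
    and \<pi>: "\<pi> permutes {..<m}" and \<rho>: "\<rho> permutes {m..<m + n}" and ys: "length ys = m + n"
  shows "juxtaposition m n P Q (permute_list (\<pi> \<circ> \<rho>) ys)
    = scale\<^sub>h (of_int (sign (\<pi> \<circ> \<rho>))) (juxtaposition m n P Q ys)"
proof -
  obtain \<rho>' where \<rho>': "\<rho>' permutes {..<n}" "\<rho> = map_permutation {..<n} ((+) m) \<rho>'"
    using bij_betw_imp_surj_on[OF bij_betw_final_block[of n m]] \<rho> by blast
  then have sgn: "sign \<rho> = sign \<rho>'"
    by (simp add: sign_map_permutation)
  have \<rho>N: "\<rho> permutes {..<length ys}" using \<rho> ys by (auto intro: permutes_subset)
  have "permute_list (\<pi> \<circ> \<rho>) ys = permute_list \<rho> (permute_list \<pi> ys)"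
    by (rule permute_list_compose[OF \<rho>N])
  also have "\<dots> = permute_list \<pi> (take m ys) @ permute_list \<rho>' (drop m ys)"
    using permute_list_final_block[OF \<rho>'(1), of "permute_list \<pi> ys" m]
      permute_list_initial_block[OF \<pi> ys] ys by (simp add: \<rho>'(2))
  finally have "permute_list (\<pi> \<circ> \<rho>) ys = permute_list \<pi> (take m ys) @ permute_list \<rho>' (drop m ys)" .
  moreover have "sign (\<pi> \<circ> \<rho>) = sign \<pi> * sign \<rho>"
    using \<pi> \<rho> by (intro sign_compose permutes_imp_permutation[rotated]) auto
  ultimately show ?thesis
    using alternating_permute[OF P \<pi>] alternating_permute[OF Q \<rho>'(1)] ys
    by (simp add: juxtaposition_def twist_power_simps bracket_simps sgn mult.commute)
qed

lemma cup_conv_alternation: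
  assumes P: "P \<in> alternating_maps scale\<^sub>g scale\<^sub>h m" and Q: "Q \<in> alternating_maps scale\<^sub>g scale\<^sub>h n"
    and xs: "length xs = m + n"
  shows "cup scale\<^sub>h bracket\<^sub>h \<beta> m n P Q xs
    = scale\<^sub>h (1 / (fact m * fact n)) (alternation (m + n) (juxtaposition m n P Q) xs)"
proof -
  let ?F = "juxtaposition m n P Q"
  let ?A = "{\<pi>. \<pi> permutes {..<m}}" and ?B = "{\<rho>. \<rho> permutes {m..<m + n}}"
  let ?t = "\<lambda>s. scale\<^sub>h (of_int (sign s)) (?F (permute_list s xs))"
  have "alternation (m + n) ?F xs = (\<Sum>(s, \<pi>, \<rho>)\<in>Sh m n \<times> ?A \<times> ?B. ?t (s \<circ> (\<pi> \<circ> \<rho>)))"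
    unfolding alternation_def
    by (subst sum.reindex_bij_betw[OF bij_betw_shuffle_decomposition, symmetric])
      (simp add: case_prod_unfold)
  also have "\<dots> = (\<Sum>(s, \<pi>, \<rho>)\<in>Sh m n \<times> ?A \<times> ?B. ?t s)"
  proof (intro sum.cong refl, clarify)
    fix s \<pi> \<rho> assume s: "s \<in> Sh m n" and p: "\<pi> permutes {..<m}" and r: "\<rho> permutes {m..<m + n}"
    have pr: "\<pi> \<circ> \<rho> permutes {..<m + n}"
      using p r by (auto intro!: permutes_compose intro: permutes_subset)
    have "permute_list (s \<circ> (\<pi> \<circ> \<rho>)) xs = permute_list (\<pi> \<circ> \<rho>) (permute_list s xs)"
      using pr xs by (intro permute_list_compose) simp
    moreover have "sign (s \<circ> (\<pi> \<circ> \<rho>)) = sign s * sign (\<pi> \<circ> \<rho>)"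
      using s pr by (intro sign_compose permutes_imp_permutation[of "{..<m + n}"]) (auto simp: Sh_def)
    moreover have "?F (permute_list (\<pi> \<circ> \<rho>) (permute_list s xs))
        = scale\<^sub>h (of_int (sign (\<pi> \<circ> \<rho>))) (?F (permute_list s xs))"
      using xs by (intro juxtaposition_block_permute[OF P Q p r]) simp
    ultimately show "?t (s \<circ> (\<pi> \<circ> \<rho>)) = ?t s"
      by (simp only: of_int_mult scale_scale[symmetric] sign_scale_cancel)
  qed
  also have "\<dots> = (\<Sum>s\<in>Sh m n. scale\<^sub>h (of_nat (fact m * fact n)) (?t s))"
    by (simp add: sum.cartesian_product[symmetric] card_permutations[OF refl] card_cartesian_product
        sum_constant_scale mult_ac del: sum_constant of_nat_mult flip: of_nat_mult)
  also have "\<dots> = scale\<^sub>h (fact m * fact n) (cup scale\<^sub>h bracket\<^sub>h \<beta> m n P Q xs)"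
    by (simp add: cup_conv_juxtaposition[OF xs] scale_sum_right)
  finally show ?thesis by simp
qed

text \<open>
  Alternation makes the bracket multilinear and alternating. Compatibility with the twists is
  checked on the sum over shuffles, where it holds term by term.
\<close>

lemma cup_in_hom_cochains:
  fixes scale\<^sub>g :: "'k \<Rightarrow> 'g::ab_group_add \<Rightarrow> 'g"
  assumes "vector_space scale\<^sub>g"
    and P: "P \<in> hom_cochains scale\<^sub>g \<alpha> scale\<^sub>h \<beta> m" and Q: "Q \<in> hom_cochains scale\<^sub>g \<alpha> scale\<^sub>h \<beta> n"
  shows "cup scale\<^sub>h bracket\<^sub>h \<beta> m n P Q \<in> hom_cochains scale\<^sub>g \<alpha> scale\<^sub>h \<beta> (m + n)"
proof -
  let ?F = "juxtaposition m n P Q" and ?c = "1 / (fact m * fact n) :: 'k"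
  let ?cup = "cup scale\<^sub>h bracket\<^sub>h \<beta> m n P Q"
  have P': "P \<in> alternating_maps scale\<^sub>g scale\<^sub>h m" and Q': "Q \<in> alternating_maps scale\<^sub>g scale\<^sub>h n"
    using P Q by (auto simp: hom_cochains_def)
  have cup: "?cup xs = scale\<^sub>h ?c (alternation (m + n) ?F xs)" if "length xs = m + n" for xs
    by (rule cup_conv_alternation[OF P' Q' that])
  have "multilinear scale\<^sub>g scale\<^sub>h (m + n) ?F"
    unfolding multilinear_def
  proof (intro allI impI, elim conjE)
    fix xs :: "'g list" and i assume xs: "length xs = m + n" "i < m + n"
    show "Vector_Spaces.linear scale\<^sub>g scale\<^sub>h (\<lambda>x. ?F (xs[i := x]))"
    proof (cases "i < m")
      case True
      then have "Vector_Spaces.linear scale\<^sub>g scale\<^sub>h (\<lambda>x. P ((take m xs)[i := x]))"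
        using P' xs by (auto simp: alternating_maps_def)
      then show ?thesis using True
        by (simp add: juxtaposition_def take_update_swap Vector_Spaces.linear_iff twist_power_simps bracket_simps)
    next
      case False
      then have "Vector_Spaces.linear scale\<^sub>g scale\<^sub>h (\<lambda>x. Q ((drop m xs)[i - m := x]))"
        using Q' xs by (auto simp: alternating_maps_def)
      then show ?thesis using False
        by (simp add: juxtaposition_def drop_update_swap Vector_Spaces.linear_iff twist_power_simps bracket_simps)
    qed
  qed
  then have "multilinear scale\<^sub>g scale\<^sub>h (m + n) (alternation (m + n) ?F)"
    by (rule multilinear_alternation[OF assms(1)])
  then have "multilinear scale\<^sub>g scale\<^sub>h (m + n) ?cup"
    by (simp add: multilinear_def cup Vector_Spaces.linear_iff scale_right_distrib mult.commute)
  moreover have "?cup xs = 0" if "length xs = m + n" "\<not> distinct xs" for xs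
    by (simp add: cup that alternation_repeated)
  moreover have "\<beta> (?cup xs) = ?cup (map \<alpha> xs)" if xs: "length xs = m + n" for xs
  proof -
    have nat: "P (map \<alpha> ys) = \<beta> (P ys)" if "length ys = m" for ys
      using P that by (auto simp: hom_cochains_def)
    have nat': "Q (map \<alpha> ys) = \<beta> (Q ys)" if "length ys = n" for ys
      using Q that by (auto simp: hom_cochains_def)
    have "?F (permute_list \<sigma> (map \<alpha> xs)) = \<beta> (?F (permute_list \<sigma> xs))" if "\<sigma> \<in> Sh m n" for \<sigma>
    proof -
      have "permute_list \<sigma> (map \<alpha> xs) = map \<alpha> (permute_list \<sigma> xs)"
        using that xs by (intro permute_list_map) (auto simp: Sh_def)
      then show ?thesis using xs
        by (simp add: juxtaposition_def take_map drop_map nat nat' multiplicative funpow_swap1)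
    qed
    then show ?thesis
      using xs by (simp add: cup_conv_juxtaposition twist_power_simps(2,3)[of 1, simplified])
  qed
  moreover have "?cup xs = 0" if "length xs \<noteq> m + n" for xs
    using that by (simp add: cup_def)
  ultimately show ?thesis
    by (auto simp: hom_cochains_def alternating_maps_def multilinear_def)
qed

lemma juxtaposition_rotate:
  assumes "length ys = m + n"
  shows "juxtaposition n m Q P (rotate m ys) = - juxtaposition m n P Q ys"
proof -
  have "rotate m ys = drop m ys @ take m ys" using assms by (cases "n = 0") (auto simp: rotate_drop_take)
  then have "juxtaposition n m Q P (rotate m ys)
      = bracket\<^sub>h ((\<beta> ^^ (m - 1)) (Q (drop m ys))) ((\<beta> ^^ (n - 1)) (P (take m ys)))"
    using assms by (simp add: juxtaposition_def)
  also have "\<dots> = - juxtaposition m n P Q ys"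
    unfolding juxtaposition_def by (rule skew_symmetric)
  finally show ?thesis .
qed

section \<open>The graded Lie algebra identities\<close>

lemma cup_skew_symmetric:
  assumes P: "P \<in> alternating_maps scale\<^sub>g scale\<^sub>h m" and Q: "Q \<in> alternating_maps scale\<^sub>g scale\<^sub>h n"
  shows "cup scale\<^sub>h bracket\<^sub>h \<beta> m n P Q xs
    = - scale\<^sub>h ((-1) ^ (m * n)) (cup scale\<^sub>h bracket\<^sub>h \<beta> n m Q P xs)"
proof (cases "length xs = m + n")
  case True
  have "alternation (m + n) (juxtaposition m n P Q) xs
      = alternation (m + n) (\<lambda>ys. scale\<^sub>h (-1) (juxtaposition n m Q P (rotate m ys))) xs"
    by (rule alternation_cong[OF _ True]) (simp add: juxtaposition_rotate)
  also have "\<dots> = - scale\<^sub>h ((-1) ^ (m * n)) (alternation (n + m) (juxtaposition n m Q P) xs)"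
    by (simp only: alternation_scale alternation_rotate[OF True]) (simp add: add.commute)
  finally show ?thesis
    using True by (simp add: cup_conv_alternation[OF P Q] cup_conv_alternation[OF Q P] mult.commute)
qed (simp add: cup_def add.commute)

text \<open>
  The integrand of \<open>[P,[Q,R]]\<close>. Of the \<open>q + r - 1\<close> twists on \<open>P\<close>, one is kept outside to match the
  Hom-Jacobi identity.
\<close>

definition nested_juxtaposition ::
  "nat \<Rightarrow> nat \<Rightarrow> nat \<Rightarrow> ('g list \<Rightarrow> 'h) \<Rightarrow> ('g list \<Rightarrow> 'h) \<Rightarrow> ('g list \<Rightarrow> 'h) \<Rightarrow> 'g list \<Rightarrow> 'h" where
  "nested_juxtaposition p q r P Q R ys =
     bracket\<^sub>h (\<beta> ((\<beta> ^^ (q + r - 2)) (P (take p ys))))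
       (bracket\<^sub>h ((\<beta> ^^ (p + r - 2)) (Q (take q (drop p ys))))
         ((\<beta> ^^ (p + q - 2)) (R (drop (p + q) ys))))"

lemma cup_cup_conv_alternation:
  fixes scale\<^sub>g :: "'k \<Rightarrow> 'g::ab_group_add \<Rightarrow> 'g"
  assumes "vector_space scale\<^sub>g"
    and P: "P \<in> hom_cochains scale\<^sub>g \<alpha> scale\<^sub>h \<beta> p" and Q: "Q \<in> hom_cochains scale\<^sub>g \<alpha> scale\<^sub>h \<beta> q"
    and R: "R \<in> hom_cochains scale\<^sub>g \<alpha> scale\<^sub>h \<beta> r"
    and pos: "p \<ge> 1" "q \<ge> 1" "r \<ge> 1" and xs: "length xs = p + q + r"
  shows "cup scale\<^sub>h bracket\<^sub>h \<beta> p (q + r) P (cup scale\<^sub>h bracket\<^sub>h \<beta> q r Q R) xs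
    = scale\<^sub>h (1 / (fact p * fact q * fact r))
        (alternation (p + q + r) (nested_juxtaposition p q r P Q R) xs)"
proof -
  have alt: "P \<in> alternating_maps scale\<^sub>g scale\<^sub>h p" "Q \<in> alternating_maps scale\<^sub>g scale\<^sub>h q"
    "R \<in> alternating_maps scale\<^sub>g scale\<^sub>h r"
    "cup scale\<^sub>h bracket\<^sub>h \<beta> q r Q R \<in> alternating_maps scale\<^sub>g scale\<^sub>h (q + r)"
    using P Q R cup_in_hom_cochains[OF assms(1) Q R] by (auto simp: hom_cochains_def)
  let ?G = "\<lambda>as z. bracket\<^sub>h ((\<beta> ^^ (q + r - 1)) (P as)) ((\<beta> ^^ (p - 1)) z)"
  let ?c = "1 / (fact q * fact r) :: 'k"
  have G: "Vector_Spaces.linear scale\<^sub>h scale\<^sub>h (?G as)" for as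
    using vector_space_axioms by (simp add: Vector_Spaces.linear_iff twist_power_simps bracket_simps)
  have xs': "length xs = p + (q + r)" using xs by simp
  have "alternation (p + (q + r)) (juxtaposition p (q + r) P (cup scale\<^sub>h bracket\<^sub>h \<beta> q r Q R)) xs
    = alternation (p + (q + r))
        (\<lambda>ys. scale\<^sub>h ?c (?G (take p ys) (alternation (q + r) (juxtaposition q r Q R) (drop p ys)))) xs"
    by (rule alternation_cong[OF _ xs'])
      (simp add: juxtaposition_def cup_conv_alternation[OF alt(2,3)] twist_power_simps bracket_simps)
  also have "\<dots> = scale\<^sub>h (?c * fact (q + r)) (alternation (p + (q + r))
      (\<lambda>ys. ?G (take p ys) (juxtaposition q r Q R (drop p ys))) xs)"
    by (simp only: alternation_scale alternation_nested[where G = ?G, OF G xs'] scale_scale)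
  also have "(\<lambda>ys. ?G (take p ys) (juxtaposition q r Q R (drop p ys)))
      = nested_juxtaposition p q r P Q R"
  proof
    fix ys
    \<comment> \<open>For degrees at least \<open>1\<close> the truncated differences are additive.\<close>
    have e: "q + r - 1 = Suc (q + r - 2)" "p + r - 2 = p - 1 + (r - 1)" "p + q - 2 = p - 1 + (q - 1)"
      using pos by auto
    show "?G (take p ys) (juxtaposition q r Q R (drop p ys)) = nested_juxtaposition p q r P Q R ys"
      unfolding nested_juxtaposition_def juxtaposition_def e
      by (simp add: twist_power_bracket funpow_add add.commute)
  qed
  finally show ?thesis
    by (simp add: cup_conv_alternation[OF alt(1,4) xs'] field_simps add.assoc)
qed

text \<open>
  Rotating by \<open>p\<close> and by \<open>p + q\<close> brings the integrands of the two cyclic rearrangements to the same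
  order of arguments as that of \<open>[P,[Q,R]]\<close>; the three integrands then sum to an instance of the
  Hom-Jacobi identity.
\<close>

lemma cup_jacobi_cyclic:
  fixes scale\<^sub>g :: "'k \<Rightarrow> 'g::ab_group_add \<Rightarrow> 'g"
  assumes "vector_space scale\<^sub>g"
    and P: "P \<in> hom_cochains scale\<^sub>g \<alpha> scale\<^sub>h \<beta> p" and Q: "Q \<in> hom_cochains scale\<^sub>g \<alpha> scale\<^sub>h \<beta> q"
    and R: "R \<in> hom_cochains scale\<^sub>g \<alpha> scale\<^sub>h \<beta> r"
    and pos: "p \<ge> 1" "q \<ge> 1" "r \<ge> 1"
  shows "cup scale\<^sub>h bracket\<^sub>h \<beta> p (q + r) P (cup scale\<^sub>h bracket\<^sub>h \<beta> q r Q R) xs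
    + scale\<^sub>h ((-1) ^ (p * (q + r)))
        (cup scale\<^sub>h bracket\<^sub>h \<beta> q (r + p) Q (cup scale\<^sub>h bracket\<^sub>h \<beta> r p R P) xs)
    + scale\<^sub>h ((-1) ^ ((p + q) * r))
        (cup scale\<^sub>h bracket\<^sub>h \<beta> r (p + q) R (cup scale\<^sub>h bracket\<^sub>h \<beta> p q P Q) xs) = 0"
proof (cases "length xs = p + q + r")
  case True
  let ?N = "p + q + r"
  let ?J1 = "nested_juxtaposition p q r P Q R"
    and ?J2 = "nested_juxtaposition q r p Q R P"
    and ?J3 = "nested_juxtaposition r p q R P Q"
  have "0 = alternation ?N (\<lambda>ys. ?J1 ys + ?J2 (rotate p ys) + ?J3 (rotate (p + q) ys)) xs"
  proof -
    have "?J1 ys + ?J2 (rotate p ys) + ?J3 (rotate (p + q) ys) = 0" if ys: "length ys = ?N" for ys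
    proof -
      have rot: "rotate p ys = drop p ys @ take p ys"
        "rotate (p + q) ys = drop (p + q) ys @ take (p + q) ys"
        using ys pos by (simp_all add: rotate_drop_take)
      have J2: "take q (rotate p ys) = take q (drop p ys)"
        "take r (drop q (rotate p ys)) = drop (p + q) ys" "drop (q + r) (rotate p ys) = take p ys"
        unfolding rot using ys by (simp_all add: add.commute)
      have J3: "take r (rotate (p + q) ys) = drop (p + q) ys"
        "take p (drop r (rotate (p + q) ys)) = take p ys"
        "drop (r + p) (rotate (p + q) ys) = take q (drop p ys)"
        unfolding rot using ys by (simp_all add: drop_take)
      show ?thesis
        unfolding nested_juxtaposition_def J2 J3
        using hom_jacobi[of "(\<beta> ^^ (q + r - 2)) (P (take p ys))"
          "(\<beta> ^^ (p + r - 2)) (Q (take q (drop p ys)))" "(\<beta> ^^ (p + q - 2)) (R (drop (p + q) ys))"]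
        by (simp add: add.commute)
    qed
    then show ?thesis using True by (simp add: alternation_def)
  qed
  also have "\<dots> = alternation ?N ?J1 xs + scale\<^sub>h ((-1) ^ (p * (q + r))) (alternation ?N ?J2 xs)
      + scale\<^sub>h ((-1) ^ ((p + q) * r)) (alternation ?N ?J3 xs)"
    using alternation_rotate[of xs p "q + r" ?J2] alternation_rotate[of xs "p + q" r ?J3] True
    by (simp add: alternation_add add.assoc)
  finally have *: "alternation ?N ?J1 xs + scale\<^sub>h ((-1) ^ (p * (q + r))) (alternation ?N ?J2 xs)
      + scale\<^sub>h ((-1) ^ ((p + q) * r)) (alternation ?N ?J3 xs) = 0" by simp
  have N: "q + r + p = ?N" "r + p + q = ?N" by simp_all
  let ?c = "1 / (fact p * fact q * fact r) :: 'k"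
  have "cup scale\<^sub>h bracket\<^sub>h \<beta> p (q + r) P (cup scale\<^sub>h bracket\<^sub>h \<beta> q r Q R) xs
      = scale\<^sub>h ?c (alternation ?N ?J1 xs)"
    "cup scale\<^sub>h bracket\<^sub>h \<beta> q (r + p) Q (cup scale\<^sub>h bracket\<^sub>h \<beta> r p R P) xs
      = scale\<^sub>h ?c (alternation ?N ?J2 xs)"
    "cup scale\<^sub>h bracket\<^sub>h \<beta> r (p + q) R (cup scale\<^sub>h bracket\<^sub>h \<beta> p q P Q) xs
      = scale\<^sub>h ?c (alternation ?N ?J3 xs)"
    using cup_cup_conv_alternation[OF assms(1) P Q R] cup_cup_conv_alternation[OF assms(1) Q R P]
      cup_cup_conv_alternation[OF assms(1) R P Q] pos True by (simp_all add: N mult_ac)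
  then show ?thesis
    using arg_cong[OF *, of "scale\<^sub>h ?c"]
    by (simp add: scale_right_distrib mult.commute[of _ ?c] del: scale_scale flip: scale_scale)
      (simp add: scale_right_distrib mult.commute)
next
  case False
  then show ?thesis by (simp add: cup_def)
qed

lemma cup_bracket_bilinear:
  "cup_bracket scale\<^sub>h bracket\<^sub>h \<beta> (P + P') Q xs
    = cup_bracket scale\<^sub>h bracket\<^sub>h \<beta> P Q xs + cup_bracket scale\<^sub>h bracket\<^sub>h \<beta> P' Q xs"
  "cup_bracket scale\<^sub>h bracket\<^sub>h \<beta> P (Q + Q') xs
    = cup_bracket scale\<^sub>h bracket\<^sub>h \<beta> P Q xs + cup_bracket scale\<^sub>h bracket\<^sub>h \<beta> P Q' xs"
  "cup_bracket scale\<^sub>h bracket\<^sub>h \<beta> (\<lambda>ys. scale\<^sub>h c (P ys)) Q xs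
    = scale\<^sub>h c (cup_bracket scale\<^sub>h bracket\<^sub>h \<beta> P Q xs)"
  "cup_bracket scale\<^sub>h bracket\<^sub>h \<beta> P (\<lambda>ys. scale\<^sub>h c (Q ys)) xs
    = scale\<^sub>h c (cup_bracket scale\<^sub>h bracket\<^sub>h \<beta> P Q xs)"
  by (simp_all add: cup_bracket_def cup_def component_def twist_power_simps bracket_simps
      sum.distrib scale_right_distrib scale_sum_right mult.commute)

text \<open>
  Cochains of different degrees are independent because they are supported on lists of different
  lengths.
\<close>

lemma graded_vector_space_hom_cochains:
  fixes scale\<^sub>g :: "'k \<Rightarrow> 'g::ab_group_add \<Rightarrow> 'g"
  assumes "vector_space scale\<^sub>g"
  shows "graded_vector_space (\<lambda>c f xs. scale\<^sub>h c (f xs)) {1..} (hom_cochains scale\<^sub>g \<alpha> scale\<^sub>h \<beta>)"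
proof -
  interpret F: vector_space "\<lambda>c (f :: 'g list \<Rightarrow> 'h) xs. scale\<^sub>h c (f xs)"
    by unfold_locales (auto simp: fun_eq_iff scale_right_distrib scale_left_distrib)
  show ?thesis
  proof unfold_locales
    fix n :: nat assume "n \<in> {1..}"
    show "F.subspace (hom_cochains scale\<^sub>g \<alpha> scale\<^sub>h \<beta> n)"
      using assms vector_space_axioms twist_power_simps[of 1, simplified]
        module_hom.zero[OF linear_twist[unfolded linear_iff_module_hom]]
      by (intro F.subspaceI)
        (auto simp: hom_cochains_def alternating_maps_def Vector_Spaces.linear_iff
          scale_right_distrib mult.commute)
  next
    fix J i and v :: "nat \<Rightarrow> 'g list \<Rightarrow> 'h"
    assume J: "finite J" "i \<in> J" and v: "\<And>j. j \<in> J \<Longrightarrow> v j \<in> hom_cochains scale\<^sub>g \<alpha> scale\<^sub>h \<beta> j"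
      and sum: "(\<Sum>j\<in>J. v j) = 0"
    have v0: "v j xs = 0" if "j \<in> J" "length xs \<noteq> j" for j xs
      using v[OF that(1)] that(2) by (auto simp: hom_cochains_def alternating_maps_def)
    have sum_apply: "(\<Sum>j\<in>A. v j) xs = (\<Sum>j\<in>A. v j xs)" if "finite A" for A xs
      using that by (induction A) auto
    show "v i = 0"
    proof
      fix xs
      show "v i xs = 0 xs"
      proof (cases "length xs = i")
        case True
        have "0 = (\<Sum>j\<in>J. v j xs)" using sum_apply[OF J(1), of xs] sum by simp
        also have "\<dots> = v i xs" using J True v0 by (subst sum.remove[of J i]) (auto intro!: sum.neutral)
        finally show ?thesis by simp
      qed (simp add: v0 J)
    qed
  qed auto
qed

end

theorem theorem3p2:
  fixes scale\<^sub>g :: "'k::field_char_0 \<Rightarrow> 'g::ab_group_add \<Rightarrow> 'g"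
    and bracket\<^sub>g :: "'g \<Rightarrow> 'g \<Rightarrow> 'g" and \<alpha> :: "'g \<Rightarrow> 'g"
    and scale\<^sub>h :: "'k \<Rightarrow> 'h::ab_group_add \<Rightarrow> 'h"
    and bracket\<^sub>h :: "'h \<Rightarrow> 'h \<Rightarrow> 'h" and \<beta> :: "'h \<Rightarrow> 'h"
  assumes "hom_lie_algebra scale\<^sub>g bracket\<^sub>g \<alpha>"
    and "hom_lie_algebra scale\<^sub>h bracket\<^sub>h \<beta>"
  shows "graded_lie_algebra (\<lambda>c f xs. scale\<^sub>h c (f xs)) {1..}
           (hom_cochains scale\<^sub>g \<alpha> scale\<^sub>h \<beta>) (cup_bracket scale\<^sub>h bracket\<^sub>h \<beta>)"
proof -
  interpret H: hom_lie_coefficients scale\<^sub>h bracket\<^sub>h \<beta>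
    using assms(2) by (rule hom_lie_coefficients.intro)
  have g: "vector_space scale\<^sub>g"
    using assms(1) by (rule hom_lie_algebra.axioms)
  interpret V: graded_vector_space "\<lambda>c (f :: 'g list \<Rightarrow> 'h) xs. scale\<^sub>h c (f xs)" "{1..}"
    "hom_cochains scale\<^sub>g \<alpha> scale\<^sub>h \<beta>"
    by (rule H.graded_vector_space_hom_cochains[OF g])
  let ?C = "hom_cochains scale\<^sub>g \<alpha> scale\<^sub>h \<beta>"
    and ?cup = "cup scale\<^sub>h bracket\<^sub>h \<beta>" and ?br = "cup_bracket scale\<^sub>h bracket\<^sub>h \<beta>"
  have homogeneous: "?br P Q = ?cup p q P Q" if "p \<ge> 1" "q \<ge> 1" "P \<in> ?C p" "Q \<in> ?C q" for p q P Q
    by (rule cup_bracket_homogeneous[OF assms(2) that])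
  have closed: "?cup p q P Q \<in> ?C (p + q)" if "P \<in> ?C p" "Q \<in> ?C q" for p q P Q
    by (rule H.cup_in_hom_cochains[OF g that])
  have skew: "?cup p q P Q xs = - scale\<^sub>h ((-1) ^ (p * q)) (?cup q p Q P xs)"
    if "P \<in> ?C p" "Q \<in> ?C q" for p q P Q xs
    using that by (intro H.cup_skew_symmetric) (auto simp: hom_cochains_def)
  show ?thesis
  proof unfold_locales
    fix p q and P Q :: "'g list \<Rightarrow> 'h"
    assume pq: "p \<in> {1..}" "q \<in> {1..}" and PQ: "P \<in> ?C p" "Q \<in> ?C q"
    then show "?br P Q \<in> ?C (p + q)"
      using closed by (simp add: homogeneous)
    show "?br P Q = - (\<lambda>xs. scale\<^sub>h ((-1) ^ (p * q)) (?br Q P xs))"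
      using pq PQ by (auto simp: homogeneous fun_eq_iff intro: skew)
  next
    fix p q r and P Q R :: "'g list \<Rightarrow> 'h"
    assume "p \<in> {1..}" "q \<in> {1..}" "r \<in> {1..}" and C: "P \<in> ?C p" "Q \<in> ?C q" "R \<in> ?C r"
    then have pos: "p \<ge> 1" "q \<ge> 1" "r \<ge> 1" by auto
    show "?br P (?br Q R) = ?br (?br P Q) R + (\<lambda>xs. scale\<^sub>h ((-1) ^ (p * q)) (?br Q (?br P R) xs))"
    proof
      fix xs
      have 1: "?br P (?br Q R) = ?cup p (q + r) P (?cup q r Q R)"
        and 2: "?br (?br P Q) R = ?cup (p + q) r (?cup p q P Q) R"
        and 3: "?br Q (?br P R) = ?cup q (p + r) Q (?cup p r P R)"
        using pos C closed by (simp_all add: homogeneous)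
      \<comment> \<open>Skew-symmetry of the inner and of the outer bracket, respectively, brings both terms on the
        right into the nested form of the cyclic identity.\<close>
      have flip: "?cup p r P R = (\<lambda>ys. scale\<^sub>h (- ((-1) ^ (p * r))) (?cup r p R P ys))"
        using skew[OF C(1,3)] by (simp add: fun_eq_iff)
      have "?cup q (r + p) Q (\<lambda>ys. scale\<^sub>h c (F ys)) xs
          = scale\<^sub>h c (?cup q (r + p) Q F xs)" for c F
        by (simp add: cup_def H.twist_power_simps H.bracket_simps H.scale_sum_right mult.commute)
      then have 4: "?cup q (p + r) Q (?cup p r P R) xs
          = scale\<^sub>h (- ((-1) ^ (p * r))) (?cup q (r + p) Q (?cup r p R P) xs)"
        unfolding flip add.commute[of p r] .
      have 5: "?cup (p + q) r (?cup p q P Q) R xs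
          = - scale\<^sub>h ((-1) ^ ((p + q) * r)) (?cup r (p + q) R (?cup p q P Q) xs)"
        by (rule skew[OF closed[OF C(1,2)] C(3)])
      show "?br P (?br Q R) xs = (?br (?br P Q) R + (\<lambda>xs. scale\<^sub>h ((-1) ^ (p * q)) (?br Q (?br P R) xs))) xs"
        using H.cup_jacobi_cyclic[OF g C pos, of xs]
        by (simp add: 1 2 3 4 5 power_add distrib_left eq_neg_iff_add_eq_0 algebra_simps)
    qed
  qed (simp_all add: fun_eq_iff H.cup_bracket_bilinear)
qed

end
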